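(* Let $\Delta\geq 3$ be an integer and let $\lambda$ be a real number with $\lambda<-\lambda^*(\Delta)$, where $\lambda^*(\Delta)=(\Delta-1)^{\Delta-1}/\Delta^{\Delta}$. Then, for every $\lambda'\in\mathbb{R}$ and for every $\epsilon>0$, there exists a bipartite graph $G$ of maximum degree at most $\Delta$ that implements the activity $\lambda'$ with error $\epsilon$ (with respect to the activity parameter $\lambda$).
   Context: Graphs are finite, simple and undirected. For a graph $G$, $\mathcal{I}_G$ denotes the set of independent sets of $G$ (including the empty set). For $\lambda\in\mathbb{R}$ and a vertex $v$ of $G$, define $$Z^{\mathsf{in}}_{G,v}(\lambda)=\sum_{I\in\mathcal{I}_G;\, v\in I}\lambda^{|I|},\qquad Z^{\mathsf{out}}_{G,v}(\lambda)=\sum_{I\in\mathcal{I}_G;\, v\notin I}\lambda^{|I|}.$$ Fix $\lambda\in\mathbb{R}\setminus\{0\}$. A graph $G$ implements the activity $\lambda'\in\mathbb{R}$ with error $\epsilon>0$ if there is a vertex $v$ of $G$ (the terminal) such that $Z^{\mathsf{out}}_{G,v}(\lambda)\neq 0$, $v$ has degree one in $G$, and $$\left|\frac{Z^{\mathsf{in}}_{G,v}(\lambda)}{Z^{\mathsf{out}}_{G,v}(\lambda)}-\lambda'\right|\leq\epsilon.$$ *)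

theory Defs
  imports Complex_Main "Graph_Theory.Pair_Digraph"
begin

text \<open>
  Finite simple undirected graphs are the library's \<^locale>\<open>pair_graph\<close>: a finite vertex set
  together with an irreflexive symmetric set of ordered pairs of vertices. Every undirected edge
  occurs as two opposite arcs, so \<^const>\<open>out_degree\<close> is the degree in the usual sense.
\<close>

definition independent_sets :: "'a pair_pre_digraph \<Rightarrow> 'a set set" where
  "independent_sets G = {I. I \<subseteq> pverts G \<and> (\<forall>u\<in>I. \<forall>w\<in>I. (u, w) \<notin> parcs G)}"

definition Z_in :: "'a pair_pre_digraph \<Rightarrow> 'a \<Rightarrow> real \<Rightarrow> real" where
  "Z_in G v lam = (\<Sum>I | I \<in> independent_sets G \<and> v \<in> I. lam ^ card I)"

definition Z_out :: "'a pair_pre_digraph \<Rightarrow> 'a \<Rightarrow> real \<Rightarrow> real" where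
  "Z_out G v lam = (\<Sum>I | I \<in> independent_sets G \<and> v \<notin> I. lam ^ card I)"

definition bipartite :: "'a pair_pre_digraph \<Rightarrow> bool" where
  "bipartite G \<longleftrightarrow>
     (\<exists>U W. pverts G = U \<union> W \<and> U \<inter> W = {} \<and> parcs G \<subseteq> U \<times> W \<union> W \<times> U)"

definition max_degree_at_most :: "'a pair_pre_digraph \<Rightarrow> nat \<Rightarrow> bool" where
  "max_degree_at_most G d \<longleftrightarrow> (\<forall>v\<in>pverts G. out_degree (with_proj G) v \<le> d)"

definition implements_activity :: "'a pair_pre_digraph \<Rightarrow> real \<Rightarrow> real \<Rightarrow> real \<Rightarrow> bool" where
  "implements_activity G lam lam' eps \<longleftrightarrow>
     (\<exists>v\<in>pverts G. Z_out G v lam \<noteq> 0 \<and> out_degree (with_proj G) v = 1 \<and>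
        \<bar>Z_in G v lam / Z_out G v lam - lam'\<bar> \<le> eps)"

definition lambda_star :: "nat \<Rightarrow> real" where
  "lambda_star d = (real d - 1) ^ (d - 1) / real d ^ d"

end

theory Submission
  imports Defs "HOL-Analysis.Analysis"
begin

text \<open>
  Put \<open>b = - lam\<close> and \<open>d = \<Delta> - 1\<close>. Joining \<open>d\<close> rooted graphs with root-vacancy ratios
  \<open>x\<^sub>i = Z_out / (Z_in + Z_out)\<close> to a new root gives the ratio \<open>1 / (1 - b x\<^sub>1 \<dots> x\<^sub>d)\<close>. Ratios
  are treated projectively, as the closed cone spanned by the pairs \<open>(Z_out, Z_in + Z_out)\<close>, so
  that vanishing partition functions cause no trouble.

  If a ratio \<open>a\<close> satisfies \<open>B = b a\<^sup>d\<^sup>-\<^sup>1 > 1 / 4\<close>, the Moebius map \<open>x \<mapsto> 1 / (1 - B x)\<close> is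
  elliptic, hence recurrent, so the cone is closed under its inverse as well. Composing the inverse
  with the \<open>d\<close>-ary operation shows that the limit ratios divided by \<open>a\<close> form a multiplicative
  semigroup. One further ratio in \<open>(0, a)\<close> then yields elements accumulating at 1 from above after
  rescaling, and with them all real ratios.

  Such an \<open>a\<close> exists: for \<open>\<lambda>\<^sup>* < b < 1\<close> the map \<open>x \<mapsto> 1 / (1 - b x\<^sup>d)\<close> has no positive fixed
  point, so the limit ratios must reach some \<open>a\<close> with \<open>b a\<^sup>d \<ge> 1\<close>; for \<open>b \<ge> 1\<close> take \<open>a = 1\<close>.
\<close>

section \<open>Closed cones of ratio pairs\<close>

text \<open>The pairs of the children are multiplied and nothing is divided out, so vanishing values
  are harmless. Three slots suffice: \<open>u\<close> and \<open>v\<close> vary in the semigroup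
  argument, and \<open>w\<close> fills the others with one fixed ratio.\<close>

definition branch :: "real \<Rightarrow> nat \<Rightarrow> real \<times> real \<Rightarrow> real \<times> real \<Rightarrow> real \<times> real \<Rightarrow> real \<times> real" where
  "branch b d u v w =
     (snd u * snd v * snd w ^ (d - 2),
      snd u * snd v * snd w ^ (d - 2) - b * (fst u * fst v * fst w ^ (d - 2)))"

text \<open>Scaling by every real makes \<open>C\<close> a set of projective points;
  \<open>(1, 1)\<close> stands for a missing child.\<close>

locale ratio_cone =
  fixes b :: real and d :: nat and C :: "(real \<times> real) set"
  assumes closed_C: "closed C"
    and scale: "u \<in> C \<Longrightarrow> c *\<^sub>R u \<in> C"
    and one: "(1, 1) \<in> C"
    and branch: "u \<in> C \<Longrightarrow> v \<in> C \<Longrightarrow> w \<in> C \<Longrightarrow> branch b d u v w \<in> C"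
    and b_pos: "b > 0"
    and d_ge: "d \<ge> 2"
begin

definition ratios :: "real set" where
  "ratios = {x. (x, 1) \<in> C}"

lemma ratioI: "(p, q) \<in> C \<Longrightarrow> q \<noteq> 0 \<Longrightarrow> p / q \<in> ratios"
  using scale[of "(p, q)" "1 / q"] by (simp add: ratios_def)

lemma closed_ratios: "closed ratios"
proof -
  have "closed ((\<lambda>x::real. (x, 1::real)) -` C)"
    by (intro closed_vimage closed_C continuous_intros)
  then show ?thesis
    by (simp add: ratios_def vimage_def)
qed

lemma one_ratio: "1 \<in> ratios"
  using one by (simp add: ratios_def)

lemma branch_ratio:
  assumes "x \<in> ratios" "y \<in> ratios" "z \<in> ratios"
  shows "(1, 1 - b * (x * y * z ^ (d - 2))) \<in> C"
  using branch[of "(x, 1)" "(y, 1)" "(z, 1)"] assms by (simp add: ratios_def branch_def)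

text \<open>With all slots but one filled by \<open>a\<close> the operation is linear in the
  remaining pair, so it also acts where \<open>q = 0\<close>, the ratio at infinity, through which
  orbits may pass.\<close>

lemma branch_fixed:
  assumes a: "a \<in> ratios" and "(p, q) \<in> C"
  shows "(q, q - b * a ^ (d - 1) * p) \<in> C"
proof -
  have "a ^ (d - 1) = a * a ^ (d - 2)"
    using d_ge by (cases d) (auto simp: power_eq_if numeral_2_eq_2 Suc_diff_le)
  then show ?thesis
    using branch[of "(p, q)" "(a, 1)" "(a, 1)"] assms
    by (simp add: ratios_def branch_def mult_ac)
qed

text \<open>
  When the discriminant of the trace-one map \<open>(p, q) \<mapsto> (q, q - B p)\<close> is negative, a multiple of
  the map is an isometry of a definite form. Hence its orbits are recurrent, and a closed cone
  invariant under it is also invariant under the inverse.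
\<close>

lemma elliptic_inverse:
  assumes B: "B > 1 / 4"
    and inv: "\<And>p q. (p, q) \<in> C \<Longrightarrow> (q, q - B * p) \<in> C"
    and pq: "(p0, q0) \<in> C"
  shows "((p0 - q0) / B, p0) \<in> C"
proof -
  \<comment> \<open>The map \<open>(p, q) \<mapsto> (q, q - B p)\<close> has determinant
    \<open>B\<close>; dividing by \<open>\<rho>\<close> gives \<open>T\<close> determinant 1. The
    form \<open>Q\<close> is then preserved, and \<open>v'\<close> is the preimage of
    \<open>v\<close> under \<open>T\<close>.\<close>
  define \<rho> where "\<rho> = sqrt B"
  define T where "T = (\<lambda>u::real \<times> real. (1 / \<rho>) *\<^sub>R (snd u, snd u - B * fst u))"
  define Q where "Q = (\<lambda>u::real \<times> real. (snd u)\<^sup>2 - fst u * snd u + B * (fst u)\<^sup>2)"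
  define K where "K = 2 + (3 / 2) / (B - 1 / 4)"
  define v where "v = (p0, q0)"
  define v' where "v' = \<rho> *\<^sub>R ((p0 - q0) / B, p0)"
  have \<rho>: "\<rho> > 0" "\<rho>\<^sup>2 = B"
    using B by (auto simp: \<rho>_def)
  have Tv': "T v' = v"
    using \<rho> B by (simp add: T_def v'_def v_def field_simps)
  have QT: "Q (T u) = Q u" for u
  proof -
    have "Q (T u) = (1 / \<rho>\<^sup>2) * ((snd u - B * fst u)\<^sup>2 - snd u * (snd u - B * fst u) + B * (snd u)\<^sup>2)"
      using \<rho>(1) by (simp add: Q_def T_def field_simps power2_eq_square)
    also have "\<dots> = Q u"
      using \<rho> B by (simp add: Q_def field_simps power2_eq_square)
    finally show ?thesis .
  qed
  have Qn: "Q ((T ^^ n) u) = Q u" for n u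
    by (induction n) (auto simp: QT)
  have Tdiff: "(T ^^ n) (u - w) = (T ^^ n) u - (T ^^ n) w" for n u w
  proof (induction n)
    case (Suc n)
    have "T (x - y) = T x - T y" for x y
      by (rule prod_eqI) (simp_all add: T_def algebra_simps diff_divide_distrib)
    then show ?case using Suc by simp
  qed simp
  have Qbound: "(norm u)\<^sup>2 \<le> K * Q u" for u
  proof -
    obtain x y where u: "u = (x, y)" by (cases u)
    \<comment> \<open>Completing the square shows that \<open>Q\<close> is definite because
      \<open>B > 1 / 4\<close>; this bounds the whole orbit.\<close>
    have Q: "Q u = (y - x / 2)\<^sup>2 + (B - 1 / 4) * x\<^sup>2"
      by (simp add: Q_def u field_simps power2_eq_square)
    have x: "x\<^sup>2 \<le> Q u / (B - 1 / 4)"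
      using B by (simp add: Q pos_le_divide_eq mult.commute)
    have "2 * (y - x / 2)\<^sup>2 + x\<^sup>2 / 2 - y\<^sup>2 = (y - x)\<^sup>2"
      by (simp add: field_simps power2_eq_square)
    then have "y\<^sup>2 \<le> 2 * (y - x / 2)\<^sup>2 + x\<^sup>2 / 2"
      using zero_le_power2[of "y - x"] by linarith
    moreover have "(y - x / 2)\<^sup>2 \<le> Q u"
      using B by (simp add: Q)
    ultimately have "x\<^sup>2 + y\<^sup>2 \<le> 2 * Q u + 3 / 2 * (Q u / (B - 1 / 4))"
      using x by linarith
    also have "\<dots> = K * Q u"
      by (simp add: K_def algebra_simps)
    finally show ?thesis
      by (simp add: u norm_Pair)
  qed
  have K: "K > 0"
    using B by (simp add: K_def add_pos_pos)
  have TC: "(T ^^ n) v \<in> C" for n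
  proof (induction n)
    case (Suc n)
    have "T u \<in> C" if "u \<in> C" for u
      unfolding T_def using that inv[of "fst u" "snd u"] by (intro scale) auto
    then show ?case using Suc by simp
  qed (use pq in \<open>simp add: v_def\<close>)
  have "norm ((T ^^ n) v) \<le> sqrt (K * Q v)" for n
    using Qbound[of "(T ^^ n) v"] by (simp add: Qn real_le_rsqrt)
  then have "bounded (range (\<lambda>n. (T ^^ n) v))"
    by (auto simp: bounded_iff)
  then obtain l r where r: "strict_mono r" and lim: "((\<lambda>n. (T ^^ n) v) \<circ> r) \<longlonglongrightarrow> l"
    using bounded_imp_convergent_subsequence by blast
  \<comment> \<open>One step less than the gap between two near-return times nearly undoes
    \<open>T\<close> on \<open>v\<close>: the isometry \<open>T ^^ Suc (r n)\<close> carries the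
    error \<open>(T ^^ k n) v - v'\<close> to a difference of consecutive terms of the subsequence,
    which tends to 0.\<close>
  define k where "k = (\<lambda>n. r (Suc n) - Suc (r n))"
  have k: "r (Suc n) = Suc (r n) + k n" for n
  proof -
    have "r n < r (Suc n)"
      using r by (simp add: strict_mono_Suc_iff)
    then show ?thesis by (simp add: k_def)
  qed
  have "Q ((T ^^ k n) v - v') = Q ((T ^^ r (Suc n)) v - (T ^^ r n) v)" for n
  proof -
    have "Q ((T ^^ k n) v - v') = Q ((T ^^ Suc (r n)) ((T ^^ k n) v - v'))"
      by (simp only: Qn)
    also have "(T ^^ Suc (r n)) ((T ^^ k n) v - v') = (T ^^ r (Suc n)) v - (T ^^ r n) v"
      by (simp only: Tdiff k funpow_add o_apply) (simp add: funpow_swap1 Tv' Tdiff)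
    finally show ?thesis .
  qed
  moreover have "(\<lambda>n. Q ((T ^^ r (Suc n)) v - (T ^^ r n) v)) \<longlonglongrightarrow> Q (l - l)"
    unfolding Q_def using lim LIMSEQ_Suc[OF lim]
    by (intro tendsto_intros) (auto simp: o_def)
  ultimately have "(\<lambda>n. K * Q ((T ^^ k n) v - v')) \<longlonglongrightarrow> K * 0"
    by (intro tendsto_mult) (auto simp: Q_def)
  then have "(\<lambda>n. K * Q ((T ^^ k n) v - v')) \<longlonglongrightarrow> 0"
    by simp
  then have "(\<lambda>n. (norm ((T ^^ k n) v - v'))\<^sup>2) \<longlonglongrightarrow> 0"
    by (rule tendsto_sandwich[rotated 3, OF _ , where f = "\<lambda>_. 0"]) (auto simp: Qbound)
  then have "(\<lambda>n. sqrt ((norm ((T ^^ k n) v - v'))\<^sup>2)) \<longlonglongrightarrow> sqrt 0"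
    by (rule tendsto_real_sqrt)
  then have "(\<lambda>n. (T ^^ k n) v) \<longlonglongrightarrow> v'"
    by (simp add: tendsto_norm_zero_iff LIM_zero_iff)
  then have "v' \<in> C"
    using closed_C TC by (metis closed_sequentially)
  then have "(1 / \<rho>) *\<^sub>R v' \<in> C"
    by (rule scale)
  then show ?thesis
    using \<rho> by (simp add: v'_def)
qed

text \<open>The powers of \<open>e / a\<close> lie in \<open>W\<close> and tend to 0; the Moebius
  images of \<open>a\<close> times them tend to 1 from above and serve as arbitrarily fine
  multiplicative steps. This yields the positive reals, limits yield 0, and the Moebius map beyond
  its pole yields the negatives.\<close>

lemma ratios_UNIV:
  assumes a: "a \<in> ratios" and e: "e \<in> ratios" "0 < e" "e < a"
    and B: "b * a ^ (d - 1) > 1 / 4"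
  shows "ratios = UNIV"
proof -
  define B where "B = b * a ^ (d - 1)"
  define W where "W = {w. a * w \<in> ratios}"
  have a0: "a > 0" and B0: "B > 0"
    using e B by (auto simp: B_def)
  have fwd: "1 / (1 - B * x) \<in> ratios" if "x \<in> ratios" "B * x \<noteq> 1" for x
    using branch_fixed[OF a, of x 1] that
    by (intro ratioI) (auto simp: B_def ratios_def)
  have bwd: "((p - q) / B, p) \<in> C" if "(p, q) \<in> C" for p q
    using elliptic_inverse[of B p q] branch_fixed[OF a] B that by (auto simp: B_def)
  \<comment> \<open>Branching on \<open>a x\<close>, \<open>a y\<close> and copies of
    \<open>a\<close> gives the ratio \<open>1 / (1 - B a x y)\<close>; the inverse Moebius map
    strips the new root and leaves \<open>a x y\<close>.\<close>
  have mult: "x * y \<in> W" if "x \<in> W" "y \<in> W" for x y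
  proof -
    have pow: "a ^ (d - 1) = a * a ^ (d - 2)"
      using d_ge by (cases d) (auto simp: power_eq_if numeral_2_eq_2 Suc_diff_le)
    have "(1, 1 - b * ((a * x) * (a * y) * a ^ (d - 2))) \<in> C"
      using that a by (intro branch_ratio) (auto simp: W_def)
    from bwd[OF this] have "(b * ((a * x) * (a * y) * a ^ (d - 2)) / B, 1) \<in> C"
      by simp
    moreover have "b * ((a * x) * (a * y) * a ^ (d - 2)) / B = a * (x * y)"
      using a0 b_pos unfolding B_def pow by simp
    ultimately show ?thesis
      by (simp add: W_def ratios_def)
  qed
  have W1: "1 \<in> W"
    using a by (simp add: W_def)
  have power: "x ^ n \<in> W" if "x \<in> W" for x n
    by (induction n) (auto simp: W1 mult that)
  define r where "r = e / a"
  have r: "0 < r" "r < 1" "r \<in> W"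
    using e a0 by (auto simp: r_def W_def)
  have rlim: "(\<lambda>m. r ^ m) \<longlonglongrightarrow> 0"
    using r by (intro LIMSEQ_power_zero) auto
  define s where "s = (\<lambda>m. 1 / (1 - B * (a * r ^ m)))"
  have slim: "s \<longlonglongrightarrow> 1 / (1 - B * (a * 0))"
    unfolding s_def by (intro tendsto_intros rlim) auto
  have ev: "\<forall>\<^sub>F m in sequentially. r ^ m < 1 / (B * a)"
    using rlim B0 a0 by (intro order_tendstoD) auto
  have sW: "s m / a \<in> W" "s m > 1" if m: "r ^ m < 1 / (B * a)" for m
  proof -
    have lt: "B * (a * r ^ m) < 1" and pos: "B * (a * r ^ m) > 0"
      using m B0 a0 r by (simp_all add: field_simps)
    have "s m \<in> ratios"
      unfolding s_def using power[OF r(3), of m] lt by (intro fwd) (auto simp: W_def)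
    then show "s m / a \<in> W"
      using a0 by (simp add: W_def)
    show "s m > 1"
      unfolding s_def using lt pos by (simp add: field_simps)
  qed
  \<comment> \<open>Only \<open>s m / a\<close> is known to lie in \<open>W\<close>, not
    \<open>s m\<close>. A factor \<open>V > a\<close> repairs this: \<open>V * (s m / a)\<close> is
    \<open>U * s m\<close> with \<open>U = V / a > 1\<close>.\<close>
  have "\<exists>V\<in>W. V > a"
  proof -
    \<comment> \<open>The bound \<open>1 / g\<close> makes \<open>x\<close> so small that its
      preimage \<open>(x - 1) / (B x)\<close> is negative and exceeds \<open>a (1 + a)\<close> in
      absolute value. Divided by \<open>a\<close> and squared, it is an element of \<open>W\<close>
      above \<open>(1 + a)^2 > a\<close>.\<close>
    define g where "g = a * (1 + B * a * (1 + a))"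
    have "g > 0"
      using a0 B0 by (simp add: g_def add_pos_pos)
    then have "\<forall>\<^sub>F m in sequentially. r ^ m < 1 / g"
      using rlim by (intro order_tendstoD) auto
    then obtain m where "r ^ m < 1 / g"
      by (auto simp: eventually_sequentially)
    define x where "x = a * r ^ m"
    have x0: "x > 0" and xr: "x \<in> ratios"
      using a0 r power[OF r(3), of m] by (auto simp: x_def W_def)
    have "x * (1 + B * a * (1 + a)) < 1"
      using \<open>r ^ m < 1 / g\<close> \<open>g > 0\<close> by (simp add: x_def g_def field_simps)
    then have x1: "(1 - x) / (B * x * a) > 1 + a"
      using x0 B0 a0 by (simp add: field_simps)
    have "((x - 1) / B, x) \<in> C"
      using bwd xr by (simp add: ratios_def)
    then have "(x - 1) / B / x \<in> ratios"
      using x0 by (intro ratioI) auto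
    moreover have "(x - 1) / B / x = a * - ((1 - x) / (B * x * a))"
      using a0 B0 x0 by (simp add: field_simps)
    ultimately have "- ((1 - x) / (B * x * a)) \<in> W"
      by (simp add: W_def)
    from mult[OF this this] have "((1 - x) / (B * x * a))\<^sup>2 \<in> W"
      by (simp add: power2_eq_square)
    moreover have "((1 - x) / (B * x * a))\<^sup>2 > a"
    proof -
      have "(1 + a) * (1 + a) < ((1 - x) / (B * x * a)) * ((1 - x) / (B * x * a))"
        using x1 a0 by (intro mult_strict_mono) auto
      moreover have "a < (1 + a) * (1 + a)"
        using a0 by (simp add: algebra_simps add_pos_pos)
      ultimately show ?thesis by (simp only: power2_eq_square)
    qed
    ultimately show ?thesis by blast
  qed
  then obtain V where V: "V \<in> W" "V > a" by blast
  define U where "U = V / a"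
  have U1: "U > 1"
    using V a0 by (simp add: U_def)
  have aW: "1 / a \<in> W"
    using one_ratio a0 by (simp add: W_def)
  have UW: "U \<in> W"
    using mult[OF V(1) aW] by (simp add: U_def)
  text \<open>
    For large \<open>n\<close> the products \<open>(U \<sigma>)\<^sup>j U\<^sup>n\<^sup>-\<^sup>j r\<^sup>k\<close> with \<open>\<sigma> = s m\<close> and \<open>j \<le> n\<close> form a grid of ratio
    \<open>\<sigma>\<close> below \<open>U\<^sup>n\<close>, since \<open>\<sigma>\<^sup>n > 1 / r\<close>.
  \<close>
  have approx: "\<exists>w\<in>W. 0 < w \<and> w \<le> t \<and> t < s m * w"
    if t: "t > 0" and m: "r ^ m < 1 / (B * a)" for t m
  proof -
    define \<sigma> where "\<sigma> = s m"
    have \<sigma>1: "\<sigma> > 1" and UsW: "U * \<sigma> \<in> W"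
      using sW[OF m] mult[OF V(1) sW(1)[OF m]] by (auto simp: \<sigma>_def U_def)
    obtain n1 where n1: "\<sigma> ^ n1 > 1 / r"
      using real_arch_pow[OF \<sigma>1] by blast
    obtain n2 where n2: "U ^ n2 > t"
      using real_arch_pow[OF U1] by blast
    define n where "n = max n1 n2"
    have n\<sigma>: "\<sigma> ^ n > 1 / r"
      using n1 by (rule less_le_trans) (use \<sigma>1 in \<open>intro power_increasing, auto simp: n_def\<close>)
    have nU: "U ^ n > t"
      using n2 by (rule less_le_trans) (use U1 in \<open>intro power_increasing, auto simp: n_def\<close>)
    have U0: "U ^ n > 0"
      using U1 by simp
    define k where "k = (LEAST k. U ^ n * r ^ k \<le> t)"
    obtain k0 where "r ^ k0 < t / U ^ n"
      using real_arch_pow_inv[of "t / U ^ n" r] r t U0 by auto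
    then have "U ^ n * r ^ k0 \<le> t"
      using U0 by (simp add: field_simps)
    then have k: "U ^ n * r ^ k \<le> t"
      unfolding k_def by (rule LeastI)
    then have "k \<noteq> 0"
      using nU by (cases k) auto
    then obtain k' where k': "k = Suc k'"
      using not0_implies_Suc by blast
    have "\<not> U ^ n * r ^ k' \<le> t"
      using not_less_Least[of k' "\<lambda>k. U ^ n * r ^ k \<le> t"] k' by (simp add: k_def)
    then have kt: "t < U ^ n * r ^ k * (1 / r)"
      using r by (simp add: k')
    define c where "c = U ^ n * r ^ k"
    have c0: "c > 0"
      using U0 r by (simp add: c_def)
    have "c * (1 / r) < c * \<sigma> ^ n"
      using n\<sigma> c0 by (rule mult_strict_left_mono)
    then have cn: "t < c * \<sigma> ^ n"
      using kt by (simp add: c_def)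
    define i where "i = (LEAST i. t < c * \<sigma> ^ i)"
    have i: "t < c * \<sigma> ^ i" and "i \<le> n"
      unfolding i_def using cn by (auto intro: LeastI Least_le)
    have "i \<noteq> 0"
      using i k by (cases i) (auto simp: c_def)
    then obtain j where j: "i = Suc j"
      using not0_implies_Suc by blast
    have "\<not> t < c * \<sigma> ^ j"
      using not_less_Least[of j "\<lambda>i. t < c * \<sigma> ^ i"] j by (simp add: i_def)
    \<comment> \<open>Each \<open>\<sigma>\<close> has to be paired with a \<open>U\<close>; the
      factor \<open>U ^ n\<close> inside \<open>c\<close> pays for up to \<open>n\<close> of
      them.\<close>
    moreover have "c * \<sigma> ^ j \<in> W"
    proof -
      have "j \<le> n" using \<open>i \<le> n\<close> j by simp
      then have "c * \<sigma> ^ j = (U * \<sigma>) ^ j * U ^ (n - j) * r ^ k"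
        by (simp add: c_def power_mult_distrib flip: power_add)
      then show ?thesis
        using UsW UW r(3) by (simp add: mult power)
    qed
    ultimately show ?thesis
      using i c0 \<sigma>1 by (intro bexI[of _ "c * \<sigma> ^ j"]) (auto simp: j \<sigma>_def mult_ac)
  qed
  have closedW: "closed W"
  proof -
    have "closed ((*) a -` ratios)"
      by (intro closed_vimage closed_ratios continuous_intros)
    then show ?thesis
      by (simp add: W_def vimage_def)
  qed
  have posW: "t \<in> W" if t: "t > 0" for t
  proof -
    obtain m0 where m0: "\<And>m. m \<ge> m0 \<Longrightarrow> r ^ m < 1 / (B * a)"
      using ev by (auto simp: eventually_sequentially)
    have "\<forall>m. \<exists>w. w \<in> W \<and> 0 < w \<and> w \<le> t \<and> t < s (m + m0) * w"
      using approx[OF t m0] by (metis le_add2)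
    then obtain w where w: "\<And>m. w m \<in> W \<and> 0 < w m \<and> w m \<le> t \<and> t < s (m + m0) * w m"
      by metis
    have "(\<lambda>m. t / s (m + m0)) \<longlonglongrightarrow> t / 1"
      using slim by (intro tendsto_intros LIMSEQ_ignore_initial_segment) auto
    then have lim: "(\<lambda>m. t / s (m + m0)) \<longlonglongrightarrow> t"
      by simp
    have "t / s (m + m0) \<le> w m" for m
      using w[of m] sW(2)[OF m0[of "m + m0"]] by (simp add: field_simps)
    then have "w \<longlonglongrightarrow> t"
      by (intro tendsto_sandwich[OF _ _ lim tendsto_const]) (use w in auto)
    then show ?thesis
      using closedW w by (metis closed_sequentially)
  qed
  have pos: "x \<in> ratios" if "x > 0" for x
    using posW[of "x / a"] that a0 by (simp add: W_def)
  have zero: "0 \<in> ratios"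
  proof -
    have "(\<lambda>n. 1 / real (Suc n)) \<longlonglongrightarrow> 0"
      by (rule LIMSEQ_Suc[OF lim_1_over_n])
    moreover have "1 / real (Suc n) \<in> ratios" for n
      by (rule pos) simp
    ultimately show ?thesis
      using closed_ratios by (metis closed_sequentially)
  qed
  have neg: "x \<in> ratios" if "x < 0" for x
  proof -
    have "1 / x < 0"
      using that by simp
    \<comment> \<open>This is the preimage of \<open>x\<close> under the Moebius map.\<close>
    then have "(1 - 1 / x) / B > 0"
      using B0 by (intro divide_pos_pos) auto
    then have "1 / (1 - B * ((1 - 1 / x) / B)) \<in> ratios"
      using that B0 by (intro fwd pos) auto
    then show ?thesis
      using B0 by simp
  qed
  show ?thesis
    using pos zero neg by (metis UNIV_eq_I linorder_neqE_linordered_idom)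
qed

section \<open>Reaching the elliptic regime above the threshold\<close>

lemma critical_gap:
  assumes b: "b > lambda_star (Suc d)" and x: "x > 0"
  shows "x - b * x ^ Suc d < 1"
proof -
  define D where "D = real d"
  have D: "D > 0" using d_ge by (simp add: D_def)
  \<comment> \<open>\<open>lambda_star (Suc d)\<close> is the maximum of
    \<open>(x - 1) / x ^ Suc d\<close> over positive \<open>x\<close>, attained at
    \<open>x = (D + 1) / D\<close>. The variable \<open>z\<close> moves this point to 1, where
    Bernoulli's inequality is the tangent line bound.\<close>
  define z where "z = x * D / (D + 1)"
  have "1 + real (Suc d) * (z - 1) \<le> (1 + (z - 1)) ^ Suc d"
    using D x by (intro Bernoulli_inequality) (simp add: z_def)
  then have bern: "(D + 1) * z - D \<le> z ^ Suc d"
    by (simp add: D_def algebra_simps)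
  have "z ^ Suc d / D = x ^ Suc d * D ^ Suc d / (D + 1) ^ Suc d / D"
    by (simp only: z_def power_divide power_mult_distrib)
  also have "\<dots> = D ^ d / (D + 1) ^ Suc d * x ^ Suc d"
    using D by simp
  also have "D ^ d / (D + 1) ^ Suc d = lambda_star (Suc d)"
    by (simp add: lambda_star_def D_def add.commute)
  finally have "lambda_star (Suc d) * x ^ Suc d = z ^ Suc d / D" ..
  moreover have "(D + 1) * z / D = x"
    using D by (simp add: z_def)
  moreover have "((D + 1) * z - D) / D \<le> z ^ Suc d / D"
    using bern D by (intro divide_right_mono) auto
  ultimately have "x - 1 \<le> lambda_star (Suc d) * x ^ Suc d"
    using D by (simp add: diff_divide_distrib)
  also have "\<dots> < b * x ^ Suc d"
    using b x by (intro mult_strict_right_mono) auto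
  finally show ?thesis by simp
qed

text \<open>Follows from \<open>d + 1 \<le> 2 ^ d\<close> and \<open>d + 1 \<le> 2 * d\<close>. It
  serves to turn \<open>b * a ^ d \<ge> 1\<close> into the ellipticity condition
  \<open>b * a ^ (d - 1) > 1 / 4\<close>.\<close>

lemma lambda_star_ge_quarter_power: "lambda_star (Suc d) \<ge> (1 / 4) ^ d"
proof -
  define X where "X = (real d + 1) ^ d * (real d + 1)"
  have "d + 1 \<le> 2 ^ d"
    by (induction d) auto
  moreover have "(d + 1) ^ d \<le> (2 * d) ^ d"
    using d_ge by (intro power_mono) auto
  ultimately have "(d + 1) ^ d * (d + 1) \<le> (2 * d) ^ d * 2 ^ d"
    by (intro mult_mono) auto
  also have "\<dots> = d ^ d * 4 ^ d"
    using power_mult_distrib[of "2 :: nat" 2 d] by (simp add: power_mult_distrib)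
  finally have "real ((d + 1) ^ d * (d + 1)) \<le> real (d ^ d * 4 ^ d)"
    by (rule of_nat_mono)
  then have le: "X \<le> real d ^ d * 4 ^ d"
    by (simp only: X_def of_nat_mult of_nat_power of_nat_add of_nat_1 of_nat_numeral)
  have "(1 / 4) ^ d * X = X / 4 ^ d"
    by (simp add: power_divide)
  also have "\<dots> \<le> real d ^ d"
    using le by (simp add: pos_divide_le_eq)
  finally have "(1 / 4) ^ d * X \<le> real d ^ d" .
  moreover have "X > 0"
    by (simp add: X_def add_nonneg_pos)
  ultimately have "(1 / 4) ^ d \<le> real d ^ d / X"
    by (simp only: pos_le_divide_eq)
  also have "\<dots> = lambda_star (Suc d)"
    by (simp add: lambda_star_def X_def add.commute mult.commute)
  finally show ?thesis .
qed

text \<open>If every ratio \<open>x \<ge> 1\<close> had \<open>b * x ^ d < 1\<close>, these ratios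
  would form a compact set, and by \<open>critical_gap\<close> its maximum would be mapped to a
  larger ratio.\<close>

lemma ratios_UNIV_if_subcritical:
  assumes b: "b > lambda_star (Suc d)" "b < 1"
  shows "ratios = UNIV"
proof -
  have "\<exists>a\<in>ratios. a \<ge> 1 \<and> b * a ^ d \<ge> 1"
  proof (rule ccontr)
    assume "\<not> ?thesis"
    then have small: "b * x ^ d < 1" if "x \<in> ratios" "x \<ge> 1" for x
      using that by force
    define A where "A = ratios \<inter> {1..}"
    have "x \<le> 1 / b" if "x \<in> A" for x
    proof -
      have "x ^ 1 \<le> x ^ d"
        using that d_ge by (intro power_increasing) (auto simp: A_def)
      then have "b * x \<le> b * x ^ d"
        using b_pos by simp
      also have "\<dots> < 1"
        using small[of x] that by (simp add: A_def)
      finally show ?thesis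
        using b_pos by (simp add: pos_le_divide_eq mult.commute)
    qed
    then have bdd: "bdd_above A"
      by (rule bdd_aboveI)
    have "A \<noteq> {}" "closed A"
      using one_ratio closed_ratios by (auto simp: A_def)
    then have "Sup A \<in> A"
      using bdd closed_contains_Sup by blast
    then have y: "Sup A \<in> ratios" "Sup A \<ge> 1"
      by (auto simp: A_def)
    define y where "y = Sup A"
    obtain e where "d = 2 + e"
      using d_ge le_Suc_ex by blast
    then have pow: "y * y * y ^ (d - 2) = y ^ d"
      by simp
    have lt: "b * y ^ d < 1"
      using small y by (simp add: y_def)
    have "1 / (1 - b * y ^ d) \<in> ratios"
      using branch_ratio[of y y y] y lt pow by (intro ratioI) (auto simp: y_def)
    moreover have gt: "y < 1 / (1 - b * y ^ d)"
      using critical_gap[OF b(1), of y] y lt by (simp add: y_def field_simps)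
    ultimately have "1 / (1 - b * y ^ d) \<in> A"
      using y by (auto simp: A_def y_def)
    then have "1 / (1 - b * y ^ d) \<le> y"
      unfolding y_def by (intro cSup_upper bdd)
    then show False using gt by simp
  qed
  then obtain a where a: "a \<in> ratios" "a \<ge> 1" "b * a ^ d \<ge> 1" by blast
  have "a \<noteq> 1" using a b by auto
  have "(1 / 4) ^ d < b"
    using b lambda_star_ge_quarter_power by simp
  \<comment> \<open>The \<open>d\<close>-th power of \<open>b * a ^ (d - 1)\<close> is
    \<open>b * (b * a ^ d) ^ (d - 1)\<close>, whose second factor is at least 1.\<close>
  also have "\<dots> \<le> b * (b * a ^ d) ^ (d - 1)"
    using a b_pos by (simp add: one_le_power)
  also have "\<dots> = (b * a ^ (d - 1)) ^ d"
    using d_ge by (cases d) (simp_all add: power_mult_distrib mult_ac flip: power_mult)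
  finally have "1 / 4 < b * a ^ (d - 1)"
    by (rule power_less_imp_less_base) (use a b_pos in auto)
  then show ?thesis
    using a \<open>a \<noteq> 1\<close> one_ratio by (intro ratios_UNIV[of a 1]) auto
qed

text \<open>With \<open>a = 1\<close>, two applications of \<open>x \<mapsto> 1 / (1 - b x)\<close>
  to 1 give \<open>(b - 1) / (2 b - 1)\<close>, which lies strictly between 0 and 1.\<close>

lemma ratios_UNIV_if_supercritical:
  assumes "b > 1"
  shows "ratios = UNIV"
proof -
  have "(1, 1 - b) \<in> C"
    using branch_ratio[OF one_ratio one_ratio one_ratio] by simp
  then have "(1 - b, 1 - b - b) \<in> C"
    using branch_fixed[OF one_ratio, of 1 "1 - b"] by simp
  then have "(1 - b) / (1 - b - b) \<in> ratios"
    using assms by (intro ratioI) auto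
  then show ?thesis
    using assms one_ratio
    by (intro ratios_UNIV[of 1 "(1 - b) / (1 - b - b)"]) (auto simp: field_simps)
qed

text \<open>At \<open>b = 1\<close> the same map sends 1 to infinity, then to 0, then back to 1, so
  a ratio between 0 and 1 has to come from elsewhere.\<close>

lemma ratios_UNIV_above_threshold:
  assumes "b > lambda_star (Suc d)" and "b = 1 \<Longrightarrow> 1 / 2 \<in> ratios"
  shows "ratios = UNIV"
proof (cases b "1 :: real" rule: linorder_cases)
  case equal
  then show ?thesis
    using assms(2) one_ratio by (intro ratios_UNIV[of 1 "1 / 2"]) auto
qed (use assms ratios_UNIV_if_subcritical ratios_UNIV_if_supercritical in auto)

end

section \<open>Joining rooted graphs\<close>

lemma degree_eq: "out_degree (with_proj G) v = card {e \<in> parcs G. fst e = v}"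
  by (simp add: out_degree_def out_arcs_def)

text \<open>Even and odd labels keep the disjoint union on \<open>nat\<close>, so joins can be
  iterated.\<close>

definition join :: "nat pair_pre_digraph \<Rightarrow> nat \<Rightarrow> nat pair_pre_digraph \<Rightarrow> nat \<Rightarrow> nat pair_pre_digraph" where
  "join G r H s =
     \<lparr>pverts = (\<lambda>x. 2 * x) ` pverts G \<union> (\<lambda>x. Suc (2 * x)) ` pverts H,
      parcs = (\<lambda>(x, y). (2 * x, 2 * y)) ` parcs G \<union> (\<lambda>(x, y). (Suc (2 * x), Suc (2 * y))) ` parcs H
        \<union> {(2 * r, Suc (2 * s)), (Suc (2 * s), 2 * r)}\<rparr>"

lemma double_in_pverts_join [simp]: "2 * x \<in> pverts (join G r H s) \<longleftrightarrow> x \<in> pverts G"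
  and Suc_double_in_pverts_join [simp]: "Suc (2 * y) \<in> pverts (join G r H s) \<longleftrightarrow> y \<in> pverts H"
  by (auto simp: join_def double_not_eq_Suc_double Suc_double_not_eq_double)

lemma parcs_join [simp]:
  "(2 * x, 2 * x') \<in> parcs (join G r H s) \<longleftrightarrow> (x, x') \<in> parcs G"
  "(Suc (2 * y), Suc (2 * y')) \<in> parcs (join G r H s) \<longleftrightarrow> (y, y') \<in> parcs H"
  "(2 * x, Suc (2 * y)) \<in> parcs (join G r H s) \<longleftrightarrow> x = r \<and> y = s"
  "(Suc (2 * y), 2 * x) \<in> parcs (join G r H s) \<longleftrightarrow> x = r \<and> y = s"
  by (auto simp: join_def double_not_eq_Suc_double Suc_double_not_eq_double)

lemma double_cases:
  fixes n :: nat
  obtains x where "n = 2 * x" | y where "n = Suc (2 * y)"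
  by (metis evenE oddE Suc_eq_plus1)

lemma pair_graph_join:
  assumes "pair_graph G" "pair_graph H" "r \<in> pverts G" "s \<in> pverts H"
  shows "pair_graph (join G r H s)"
proof -
  interpret G: pair_graph G by fact
  interpret H: pair_graph H by fact
  let ?J = "join G r H s"
  have G: "(y, x) \<in> parcs G" if "(x, y) \<in> parcs G" for x y
    using G.pair_sym_arcs that by (auto simp: symmetric_def sym_def)
  have H: "(y, x) \<in> parcs H" if "(x, y) \<in> parcs H" for x y
    using H.pair_sym_arcs that by (auto simp: symmetric_def sym_def)
  have arc: "fst e \<in> pverts ?J \<and> snd e \<in> pverts ?J \<and> fst e \<noteq> snd e \<and> prod.swap e \<in> parcs ?J"
    if "e \<in> parcs ?J" for e
  proof -
    obtain a b where e: "e = (a, b)" by (cases e)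
    show ?thesis
      using that G H G.in_arcsD1 G.in_arcsD2 H.in_arcsD1 H.in_arcsD2 assms(3,4)
        G.no_loops' H.no_loops'
      unfolding e
      by (cases a rule: double_cases; cases b rule: double_cases)
        (auto simp: double_not_eq_Suc_double Suc_double_not_eq_double)
  qed
  show ?thesis
  proof
    show "finite (pverts ?J)" "finite (parcs ?J)"
      by (auto simp: join_def G.pair_finite_verts H.pair_finite_verts
          G.pair_finite_arcs H.pair_finite_arcs)
    show "symmetric (with_proj ?J)"
      unfolding symmetric_def sym_def using arc by fastforce
  qed (use arc in auto)
qed

lemma degree_join:
  assumes "pair_graph G" "pair_graph H"
  shows "out_degree (with_proj (join G r H s)) (2 * x) =
      out_degree (with_proj G) x + (if x = r then 1 else 0)" (is ?even)
    and "out_degree (with_proj (join G r H s)) (Suc (2 * y)) =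
      out_degree (with_proj H) y + (if y = s then 1 else 0)" (is ?odd)
proof -
  interpret G: pair_graph G by fact
  interpret H: pair_graph H by fact
  have "{e \<in> parcs (join G r H s). fst e = 2 * x} =
      (\<lambda>(x, y). (2 * x, 2 * y)) ` {e \<in> parcs G. fst e = x} \<union>
      (if x = r then {(2 * r, Suc (2 * s))} else {})"
    by (auto simp: join_def Suc_double_not_eq_double double_not_eq_Suc_double)
  moreover have "card ((\<lambda>(x, y). (2 * x, 2 * y)) ` {e \<in> parcs G. fst e = x})
      = card {e \<in> parcs G. fst e = x}"
    by (rule card_image) (auto simp: inj_on_def)
  ultimately show ?even
    unfolding degree_eq
    by (cases "x = r")
      (auto simp: G.pair_finite_arcs card_insert_if Suc_double_not_eq_double double_not_eq_Suc_double)
  have "{e \<in> parcs (join G r H s). fst e = Suc (2 * y)} =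
      (\<lambda>(x, y). (Suc (2 * x), Suc (2 * y))) ` {e \<in> parcs H. fst e = y} \<union>
      (if y = s then {(Suc (2 * s), 2 * r)} else {})"
    by (auto simp: join_def Suc_double_not_eq_double double_not_eq_Suc_double)
  moreover have "card ((\<lambda>(x, y). (Suc (2 * x), Suc (2 * y))) ` {e \<in> parcs H. fst e = y})
      = card {e \<in> parcs H. fst e = y}"
    by (rule card_image) (auto simp: inj_on_def)
  ultimately show ?odd
    unfolding degree_eq
    by (cases "y = s")
      (auto simp: H.pair_finite_arcs card_insert_if Suc_double_not_eq_double double_not_eq_Suc_double)
qed

lemma bipartite_side:
  assumes "bipartite G" "v \<in> pverts G"
  obtains U W where "pverts G = U \<union> W" "U \<inter> W = {}" "parcs G \<subseteq> U \<times> W \<union> W \<times> U" "v \<in> U"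
proof -
  obtain U W where *: "pverts G = U \<union> W" "U \<inter> W = {}" "parcs G \<subseteq> U \<times> W \<union> W \<times> U"
    using assms by (auto simp: bipartite_def)
  show ?thesis
  proof (cases "v \<in> U")
    case True
    then show ?thesis using * that by blast
  next
    case False
    then have "v \<in> W" using * assms by auto
    then show ?thesis using * by (intro that[of W U]) auto
  qed
qed

lemma bipartite_join:
  assumes "bipartite G" "bipartite H" "r \<in> pverts G" "s \<in> pverts H"
  shows "bipartite (join G r H s)"
proof -
  obtain U W where G: "pverts G = U \<union> W" "U \<inter> W = {}" "parcs G \<subseteq> U \<times> W \<union> W \<times> U" "r \<in> U"
    using bipartite_side[OF assms(1,3)] .
  obtain U' W' where H: "pverts H = U' \<union> W'" "U' \<inter> W' = {}"
    "parcs H \<subseteq> U' \<times> W' \<union> W' \<times> U'" "s \<in> U'"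
    using bipartite_side[OF assms(2,4)] .
  \<comment> \<open>The sides of \<open>H\<close> are crossed over, so that \<open>r\<close> and
    \<open>s\<close> land on opposite sides.\<close>
  define X where "X = (\<lambda>x. 2 * x) ` U \<union> (\<lambda>x. Suc (2 * x)) ` W'"
  define Y where "Y = (\<lambda>x. 2 * x) ` W \<union> (\<lambda>x. Suc (2 * x)) ` U'"
  have "pverts (join G r H s) = X \<union> Y"
    using G H by (auto simp: join_def X_def Y_def)
  moreover have "X \<inter> Y = {}"
    using G H
    by (auto simp: X_def Y_def Suc_double_not_eq_double double_not_eq_Suc_double)
  moreover have "parcs (join G r H s) \<subseteq> X \<times> Y \<union> Y \<times> X"
    using G H by (auto simp: join_def X_def Y_def)
  ultimately show ?thesis
    unfolding bipartite_def by blast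
qed

section \<open>Partition functions of a join\<close>

lemma independent_join_iff:
  assumes "r \<in> pverts G" "s \<in> pverts H"
  shows "I \<in> independent_sets (join G r H s) \<longleftrightarrow>
    (\<lambda>x. 2 * x) -` I \<in> independent_sets G \<and> (\<lambda>x. Suc (2 * x)) -` I \<in> independent_sets H \<and>
    \<not> (2 * r \<in> I \<and> Suc (2 * s) \<in> I)"
proof -
  have all: "(\<forall>n\<in>I. P n) \<longleftrightarrow> (\<forall>x. 2 * x \<in> I \<longrightarrow> P (2 * x)) \<and> (\<forall>y. Suc (2 * y) \<in> I \<longrightarrow> P (Suc (2 * y)))"
    for P :: "nat \<Rightarrow> bool"
    by (metis double_cases)
  show ?thesis
    unfolding independent_sets_def subset_eq all mem_Collect_eq vimage_eq Ball_def[of "_ -` _"]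
    by auto
qed

text \<open>A vertex set of the join corresponds to the pair of its preimages, and cardinalities
  add. Arbitrary families let one factorization serve both root states.\<close>

lemma sum_join:
  fixes lam :: real
  assumes "finite (pverts G)" "finite (pverts H)"
    and "\<And>A. A \<in> SA \<Longrightarrow> A \<subseteq> pverts G" "\<And>B. B \<in> SB \<Longrightarrow> B \<subseteq> pverts H"
  shows "(\<Sum>I | (\<lambda>x. 2 * x) -` I \<in> SA \<and> (\<lambda>x. Suc (2 * x)) -` I \<in> SB. lam ^ card I)
    = (\<Sum>A\<in>SA. lam ^ card A) * (\<Sum>B\<in>SB. lam ^ card B)"
proof -
  let ?f = "\<lambda>x::nat. 2 * x" and ?g = "\<lambda>x::nat. Suc (2 * x)"
  have vim: "?f -` (?f ` A \<union> ?g ` B) = A" "?g -` (?f ` A \<union> ?g ` B) = B" for A B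
    by (auto simp: Suc_double_not_eq_double double_not_eq_Suc_double)
  have un: "?f ` (?f -` I) \<union> ?g ` (?g -` I) = I" for I
  proof (intro set_eqI)
    fix n show "n \<in> ?f ` (?f -` I) \<union> ?g ` (?g -` I) \<longleftrightarrow> n \<in> I"
      by (cases n rule: double_cases)
        (auto simp: Suc_double_not_eq_double double_not_eq_Suc_double)
  qed
  have card: "card (?f ` A \<union> ?g ` B) = card A + card B" if "A \<in> SA" "B \<in> SB" for A B
  proof -
    have "finite A" "finite B"
      using assms that by (meson finite_subset)+
    then have "card (?f ` A \<union> ?g ` B) = card (?f ` A) + card (?g ` B)"
      by (intro card_Un_disjoint)
        (auto simp: Suc_double_not_eq_double double_not_eq_Suc_double)
    then show ?thesis
      by (simp add: card_image inj_on_def)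
  qed
  have "(\<Sum>A\<in>SA. lam ^ card A) * (\<Sum>B\<in>SB. lam ^ card B)
      = (\<Sum>(A, B)\<in>SA \<times> SB. lam ^ (card A + card B))"
    by (simp add: sum_product sum.cartesian_product power_add)
  also have "\<dots> = (\<Sum>I | ?f -` I \<in> SA \<and> ?g -` I \<in> SB. lam ^ card I)"
    by (rule sum.reindex_bij_witness[where j = "\<lambda>(A, B). ?f ` A \<union> ?g ` B"
          and i = "\<lambda>I. (?f -` I, ?g -` I)"])
      (simp_all only: mem_Collect_eq mem_Times_iff case_prod_unfold fst_conv snd_conv vim un card
        prod.collapse simp_thms)
  finally show ?thesis ..
qed

text \<open>An occupied root forces \<open>s\<close> to be vacant; a vacant root leaves
  \<open>H\<close> unconstrained.\<close>

lemma Z_join: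
  assumes "pair_graph G" "pair_graph H" "r \<in> pverts G" "s \<in> pverts H"
  shows "Z_in (join G r H s) (2 * r) lam = Z_in G r lam * Z_out H s lam" (is ?in)
    and "Z_out (join G r H s) (2 * r) lam = Z_out G r lam * (Z_in H s lam + Z_out H s lam)"
      (is ?out)
proof -
  interpret G: pair_graph G by fact
  interpret H: pair_graph H by fact
  note finite = G.pair_finite_verts H.pair_finite_verts
  have "{I. I \<in> independent_sets (join G r H s) \<and> 2 * r \<in> I} =
      {I. (\<lambda>x. 2 * x) -` I \<in> {A. A \<in> independent_sets G \<and> r \<in> A} \<and>
          (\<lambda>x. Suc (2 * x)) -` I \<in> {B. B \<in> independent_sets H \<and> s \<notin> B}}"
    using assms(3,4) by (auto simp: independent_join_iff)
  then show ?in
    unfolding Z_in_def Z_out_def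
    by (simp only:) (rule sum_join[OF finite]; simp add: independent_sets_def)
  have "{I. I \<in> independent_sets (join G r H s) \<and> 2 * r \<notin> I} =
      {I. (\<lambda>x. 2 * x) -` I \<in> {A. A \<in> independent_sets G \<and> r \<notin> A} \<and>
          (\<lambda>x. Suc (2 * x)) -` I \<in> independent_sets H}"
    using assms(3,4) by (auto simp: independent_join_iff)
  then have "Z_out (join G r H s) (2 * r) lam =
      Z_out G r lam * (\<Sum>I\<in>independent_sets H. lam ^ card I)"
    unfolding Z_in_def Z_out_def
    by (simp only:) (rule sum_join[OF finite]; simp add: independent_sets_def)
  also have "(\<Sum>I\<in>independent_sets H. lam ^ card I) = Z_in H s lam + Z_out H s lam"
  proof -
    have "finite (independent_sets H)"
      by (rule finite_subset[of _ "Pow (pverts H)"]) (auto simp: independent_sets_def finite)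
    from sum.Int_Diff[OF this, of "\<lambda>I. lam ^ card I" "{I. s \<in> I}"] show ?thesis
      by (simp add: Z_in_def Z_out_def Int_def set_diff_eq)
  qed
  finally show ?out .
qed

text \<open>The exact degree \<open>k\<close> is recorded because it decides how many further edges
  the root can take.\<close>

definition realizable :: "nat \<Rightarrow> real \<Rightarrow> nat \<Rightarrow> real \<Rightarrow> real \<Rightarrow> bool" where
  "realizable \<Delta> lam k zi zo \<longleftrightarrow>
     (\<exists>(G :: nat pair_pre_digraph) v. pair_graph G \<and> bipartite G \<and> max_degree_at_most G \<Delta> \<and>
        v \<in> pverts G \<and> out_degree (with_proj G) v = k \<and> Z_in G v lam = zi \<and> Z_out G v lam = zo)"

lemma realizable_vertex: "realizable \<Delta> lam 0 lam 1"
proof -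
  define G :: "nat pair_pre_digraph" where "G = \<lparr>pverts = {0}, parcs = {}\<rparr>"
  have G: "pverts G = {0}" "parcs G = {}"
    by (simp_all add: G_def)
  have "pair_graph G"
    by unfold_locales (auto simp: G symmetric_def sym_def)
  moreover have "bipartite G"
    unfolding bipartite_def G by (intro exI[of _ "{0}"] exI[of _ "{}"]) auto
  moreover have "max_degree_at_most G \<Delta>" "out_degree (with_proj G) 0 = 0"
    by (auto simp: max_degree_at_most_def degree_eq G)
  moreover have "{I. I \<in> independent_sets G \<and> 0 \<in> I} = {{0}}"
    "{I. I \<in> independent_sets G \<and> 0 \<notin> I} = {{}}"
    by (auto simp: independent_sets_def G)
  ultimately show ?thesis
    unfolding realizable_def
    by (intro exI[of _ G] exI[of _ 0]) (auto simp: Z_in_def Z_out_def G)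
qed

lemma realizable_join:
  assumes "realizable \<Delta> lam k zi zo" "realizable \<Delta> lam l wi wo" "k < \<Delta>" "l < \<Delta>"
  shows "realizable \<Delta> lam (Suc k) (zi * wo) (zo * (wi + wo))"
proof -
  obtain G :: "nat pair_pre_digraph" and r where
    G: "pair_graph G" "bipartite G" "max_degree_at_most G \<Delta>" "r \<in> pverts G"
      "out_degree (with_proj G) r = k" "Z_in G r lam = zi" "Z_out G r lam = zo"
    using assms(1) by (auto simp: realizable_def)
  obtain H :: "nat pair_pre_digraph" and s where
    H: "pair_graph H" "bipartite H" "max_degree_at_most H \<Delta>" "s \<in> pverts H"
      "out_degree (with_proj H) s = l" "Z_in H s lam = wi" "Z_out H s lam = wo"
    using assms(2) by (auto simp: realizable_def)
  have "max_degree_at_most (join G r H s) \<Delta>"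
    unfolding max_degree_at_most_def
  proof
    fix v assume "v \<in> pverts (join G r H s)"
    then show "out_degree (with_proj (join G r H s)) v \<le> \<Delta>"
      using G H assms(3,4)
      by (cases v rule: double_cases) (auto simp: degree_join max_degree_at_most_def)
  qed
  then show ?thesis
    unfolding realizable_def using G H
    by (intro exI[of _ "join G r H s"] exI[of _ "2 * r"])
      (simp add: pair_graph_join bipartite_join degree_join Z_join)
qed

section \<open>The six-cycle\<close>

text \<open>Used to expand a sum over all subsets of the six vertices term by term.\<close>

lemma sum_Pow_insert:
  assumes "finite A" "x \<notin> A"
  shows "sum h (Pow (insert x A)) = (\<Sum>I\<in>Pow A. h I + h (insert x I))"
proof -
  have "sum h (Pow (insert x A)) = sum h (Pow A) + sum h (insert x ` Pow A)"
    unfolding Pow_insert using assms by (intro sum.union_disjoint) auto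
  also have "sum h (insert x ` Pow A) = (\<Sum>I\<in>Pow A. h (insert x I))"
    using assms by (intro sum.reindex_cong[of "insert x"]) (auto simp: inj_on_def)
  finally show ?thesis
    by (simp add: sum.distrib)
qed

definition hexagon_edges :: "(nat \<times> nat) set" where
  "hexagon_edges = {(0,1),(1,2),(2,3),(3,4),(4,5),(5,0)}"

definition hexagon_arcs :: "(nat \<times> nat) set" where
  "hexagon_arcs = hexagon_edges \<union> hexagon_edges\<inverse>"

lemma hexagon_independent_iff:
  "(\<forall>u\<in>I. \<forall>w\<in>I. (u, w) \<notin> hexagon_arcs) \<longleftrightarrow>
     \<not> (0 \<in> I \<and> 1 \<in> I) \<and> \<not> (1 \<in> I \<and> 2 \<in> I) \<and> \<not> (2 \<in> I \<and> 3 \<in> I) \<and>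
     \<not> (3 \<in> I \<and> 4 \<in> I) \<and> \<not> (4 \<in> I \<and> 5 \<in> I) \<and> \<not> (5 \<in> I \<and> 0 \<in> I)"
proof -
  have eq: "(\<forall>u\<in>I. \<forall>w\<in>I. (u, w) \<notin> E \<union> E\<inverse>) \<longleftrightarrow> (\<forall>e\<in>E. \<not> (fst e \<in> I \<and> snd e \<in> I))"
    for E :: "(nat \<times> nat) set"
    by force
  show ?thesis
    unfolding hexagon_arcs_def eq by (simp add: hexagon_edges_def)
qed

lemma hexagon_degree:
  assumes "v \<in> {0,1,2,3,4,5}"
  shows "card {e \<in> hexagon_arcs. fst e = v} = 2"
proof -
  have "{e \<in> hexagon_arcs. fst e = 0} = {(0,1), (0,5)}" "{e \<in> hexagon_arcs. fst e = 1} = {(1,0), (1,2)}"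
    "{e \<in> hexagon_arcs. fst e = 2} = {(2,1), (2,3)}" "{e \<in> hexagon_arcs. fst e = 3} = {(3,2), (3,4)}"
    "{e \<in> hexagon_arcs. fst e = 4} = {(4,3), (4,5)}" "{e \<in> hexagon_arcs. fst e = 5} = {(5,4), (5,0)}"
    by (auto simp: hexagon_arcs_def hexagon_edges_def)
  then show ?thesis
    using assms by (elim insertE emptyE) simp_all
qed

text \<open>
  At activity \<open>-1\<close> the partition function of every forest lies in \<open>{-1, 0, 1}\<close>, so trees alone do
  not suffice there; a six-cycle supplies the missing ratio \<open>1 / 2\<close>.
\<close>

lemma realizable_hexagon:
  assumes "\<Delta> \<ge> 2"
  shows "realizable \<Delta> (- 1) 2 1 1"
proof -
  define G :: "nat pair_pre_digraph" where "G = \<lparr>pverts = {0,1,2,3,4,5}, parcs = hexagon_arcs\<rparr>"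
  have G: "pverts G = {0,1,2,3,4,5}" "parcs G = hexagon_arcs"
    by (simp_all add: G_def)
  define admissible :: "nat set \<Rightarrow> bool" where "admissible I \<longleftrightarrow>
      \<not> (0 \<in> I \<and> 1 \<in> I) \<and> \<not> (1 \<in> I \<and> 2 \<in> I) \<and> \<not> (2 \<in> I \<and> 3 \<in> I) \<and>
      \<not> (3 \<in> I \<and> 4 \<in> I) \<and> \<not> (4 \<in> I \<and> 5 \<in> I) \<and> \<not> (5 \<in> I \<and> 0 \<in> I)" for I
  \<comment> \<open>Extension by zero makes the sums run over the full power set.\<close>
  define h_in h_out :: "nat set \<Rightarrow> real" where
    "h_in I = (if 0 \<in> I \<and> admissible I then (- 1) ^ card I else 0)" and
    "h_out I = (if 0 \<notin> I \<and> admissible I then (- 1) ^ card I else 0)" for I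
  have indep: "independent_sets G = {I \<in> Pow {0,1,2,3,4,5}. admissible I}"
    unfolding independent_sets_def G hexagon_independent_iff admissible_def Pow_def by simp
  have "Z_in G 0 (- 1) = sum h_in (Pow {0,1,2,3,4,5})"
    unfolding Z_in_def indep h_in_def
    by (subst sum.inter_filter[symmetric]) (auto intro!: sum.cong)
  also have "\<dots> = 1"
    by (simp add: sum_Pow_insert) (simp add: h_in_def admissible_def)
  finally have Z_in: "Z_in G 0 (- 1) = 1" .
  have "Z_out G 0 (- 1) = sum h_out (Pow {0,1,2,3,4,5})"
    unfolding Z_out_def indep h_out_def
    by (subst sum.inter_filter[symmetric]) (auto intro!: sum.cong)
  also have "\<dots> = 1"
    by (simp add: sum_Pow_insert) (simp add: h_out_def admissible_def)
  finally have Z_out: "Z_out G 0 (- 1) = 1" .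
  have "sym hexagon_arcs"
    unfolding hexagon_arcs_def by (rule sym_Un_converse)
  define U W :: "nat set" where "U = {0,2,4}" and "W = {1,3,5}"
  have verts: "pverts G = U \<union> W"
    by (auto simp: G U_def W_def)
  have "hexagon_edges \<subseteq> U \<times> W \<union> W \<times> U"
    by (simp add: hexagon_edges_def U_def W_def)
  then have arcs: "parcs G \<subseteq> U \<times> W \<union> W \<times> U"
    unfolding G hexagon_arcs_def by blast
  have disjoint: "U \<inter> W = {}"
    by (simp add: U_def W_def)
  have "pair_graph G"
  proof
    show "fst e \<in> pverts G" "snd e \<in> pverts G" if "e \<in> parcs G" for e
      using that arcs unfolding verts by auto
    show "fst e \<noteq> snd e" if "e \<in> parcs G" for e
    proof -
      have "e \<in> U \<times> W \<union> W \<times> U"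
        using that arcs by blast
      then show ?thesis
        using disjoint by auto
    qed
    show "finite (pverts G)" "finite (parcs G)" "symmetric (with_proj G)"
      using \<open>sym hexagon_arcs\<close>
      by (simp_all add: G symmetric_def) (simp add: hexagon_arcs_def hexagon_edges_def)
  qed
  moreover have "bipartite G"
    unfolding bipartite_def using verts arcs disjoint by blast
  moreover have deg: "out_degree (with_proj G) v = 2" if "v \<in> pverts G" for v
    using that hexagon_degree by (simp add: degree_eq G)
  moreover have "max_degree_at_most G \<Delta>"
    using assms deg by (simp add: max_degree_at_most_def)
  ultimately show ?thesis
    unfolding realizable_def using Z_in Z_out by (intro exI[of _ G] exI[of _ 0]) (simp add: G)
qed

section \<open>Density of the realizable ratios\<close>

text \<open>The bound \<open>k \<le> d\<close> reserves one edge at the root for its parent;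
  \<open>(1, 1)\<close> is the missing child.\<close>

definition vertex_pairs :: "nat \<Rightarrow> real \<Rightarrow> (real \<times> real) set" where
  "vertex_pairs d lam = insert (1, 1) {(zo, zi + zo) | k zi zo. k \<le> d \<and> realizable (Suc d) lam k zi zo}"

text \<open>Children are joined one by one to a single vertex; entries \<open>(1, 1)\<close> are
  skipped, so the root degree may fall below the length of the list.\<close>

lemma realizable_star:
  assumes "set us \<subseteq> vertex_pairs d lam" "length us \<le> Suc d"
  shows "\<exists>k\<le>length us. realizable (Suc d) lam k (lam * prod_list (map fst us)) (prod_list (map snd us))"
  using assms
proof (induction us)
  case Nil
  then show ?case by (simp add: realizable_vertex)
next
  case (Cons u us)
  then obtain k where k: "k \<le> length us"
    "realizable (Suc d) lam k (lam * prod_list (map fst us)) (prod_list (map snd us))"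
    by auto
  show ?case
  proof (cases "u = (1, 1)")
    case True
    then show ?thesis using k by (intro exI[of _ k]) auto
  next
    case False
    then obtain l zi zo where u: "u = (zo, zi + zo)" "l \<le> d" "realizable (Suc d) lam l zi zo"
      using Cons.prems by (auto simp: vertex_pairs_def)
    then have "realizable (Suc d) lam (Suc k) (lam * prod_list (map fst us) * zo)
        (prod_list (map snd us) * (zi + zo))"
      using k Cons.prems by (intro realizable_join[where l = l]) auto
    then show ?thesis
      using k by (intro exI[of _ "Suc k"]) (simp add: u mult_ac)
  qed
qed

definition ratio_pairs :: "nat \<Rightarrow> real \<Rightarrow> (real \<times> real) set" where
  "ratio_pairs d lam = closure {c *\<^sub>R u | c u. u \<in> vertex_pairs d lam}"

lemma vertex_pairs_subset: "vertex_pairs d lam \<subseteq> ratio_pairs d lam"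
proof
  fix u assume "u \<in> vertex_pairs d lam"
  then have "1 *\<^sub>R u \<in> {c *\<^sub>R u | c u. u \<in> vertex_pairs d lam}"
    by blast
  then show "u \<in> ratio_pairs d lam"
    unfolding ratio_pairs_def using closure_subset by fastforce
qed

lemma branch_vertex_pairs:
  assumes "d \<ge> 2" "u \<in> vertex_pairs d lam" "v \<in> vertex_pairs d lam" "w \<in> vertex_pairs d lam"
  shows "branch (- lam) d u v w \<in> vertex_pairs d lam"
proof -
  let ?us = "u # v # replicate (d - 2) w"
  have len: "length ?us = d"
    using assms(1) by simp
  have "set ?us \<subseteq> vertex_pairs d lam"
    using assms by (auto simp: set_replicate_conv_if)
  then obtain k where "k \<le> length ?us"
    "realizable (Suc d) lam k (lam * prod_list (map fst ?us)) (prod_list (map snd ?us))"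
    using realizable_star[of ?us d lam] len by fastforce
  then have "(prod_list (map snd ?us), lam * prod_list (map fst ?us) + prod_list (map snd ?us))
      \<in> vertex_pairs d lam"
    unfolding vertex_pairs_def len by blast
  then show ?thesis
    by (simp add: branch_def algebra_simps)
qed

lemma branch_scaleR:
  "branch b d (c1 *\<^sub>R u) (c2 *\<^sub>R v) (c3 *\<^sub>R w) = (c1 * c2 * c3 ^ (d - 2)) *\<^sub>R branch b d u v w"
  by (simp add: branch_def power_mult_distrib algebra_simps)

lemma tendsto_branch:
  assumes "(f \<longlongrightarrow> u) F" "(g \<longlongrightarrow> v) F" "(h \<longlongrightarrow> w) F"
  shows "((\<lambda>x. branch b d (f x) (g x) (h x)) \<longlongrightarrow> branch b d u v w) F"
  unfolding branch_def by (intro tendsto_intros assms)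

lemma ratio_cone_ratio_pairs:
  assumes "d \<ge> 2" "lam < 0"
  shows "ratio_cone (- lam) d (ratio_pairs d lam)"
proof
  define K where "K = {c *\<^sub>R u | c u. u \<in> vertex_pairs d lam}"
  have pairs: "ratio_pairs d lam = closure K"
    by (simp add: ratio_pairs_def K_def)
  have limit: "l \<in> ratio_pairs d lam" if "\<And>n. f n \<in> K" "f \<longlonglongrightarrow> l" for f l
    unfolding pairs closure_sequential using that by (intro exI[of _ f]) auto
  show "closed (ratio_pairs d lam)"
    by (simp add: ratio_pairs_def)
  show "(1, 1) \<in> ratio_pairs d lam"
    using vertex_pairs_subset by (auto simp: vertex_pairs_def)
  show "c *\<^sub>R u \<in> ratio_pairs d lam" if u: "u \<in> ratio_pairs d lam" for c u
  proof -
    obtain f where f: "\<And>n. f n \<in> K" "f \<longlonglongrightarrow> u"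
      using u unfolding pairs closure_sequential by blast
    have "c *\<^sub>R f n \<in> K" for n
    proof -
      obtain c' u' where "f n = c' *\<^sub>R u'" "u' \<in> vertex_pairs d lam"
        using f(1)[of n] unfolding K_def by blast
      then have "c *\<^sub>R f n = (c * c') *\<^sub>R u'"
        by simp
      then show ?thesis
        unfolding K_def using \<open>u' \<in> vertex_pairs d lam\<close> by blast
    qed
    moreover have "(\<lambda>n. c *\<^sub>R f n) \<longlonglongrightarrow> c *\<^sub>R u"
      by (intro tendsto_intros f)
    ultimately show ?thesis
      by (rule limit)
  qed
  show "branch (- lam) d u v w \<in> ratio_pairs d lam"
    if uvw: "u \<in> ratio_pairs d lam" "v \<in> ratio_pairs d lam" "w \<in> ratio_pairs d lam" for u v w
  proof -
    obtain f g h where f: "\<And>n. f n \<in> K" "f \<longlonglongrightarrow> u" and g: "\<And>n. g n \<in> K" "g \<longlonglongrightarrow> v"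
      and h: "\<And>n. h n \<in> K" "h \<longlonglongrightarrow> w"
      using uvw unfolding pairs closure_sequential by blast
    have "branch (- lam) d (f n) (g n) (h n) \<in> K" for n
    proof -
      obtain c1 c2 c3 u' v' w' where eqs: "f n = c1 *\<^sub>R u'" "g n = c2 *\<^sub>R v'" "h n = c3 *\<^sub>R w'"
        and mem: "u' \<in> vertex_pairs d lam" "v' \<in> vertex_pairs d lam" "w' \<in> vertex_pairs d lam"
        using f(1)[of n] g(1)[of n] h(1)[of n] unfolding K_def by blast
      show ?thesis
        unfolding eqs branch_scaleR K_def using branch_vertex_pairs[OF assms(1) mem] by blast
    qed
    moreover have "(\<lambda>n. branch (- lam) d (f n) (g n) (h n)) \<longlonglongrightarrow> branch (- lam) d u v w"
      by (intro tendsto_branch f g h)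
    ultimately show ?thesis
      by (rule limit)
  qed
qed (use assms in auto)

section \<open>From density to implemented activities\<close>

lemma ratio_pairs_dense:
  assumes "d \<ge> 2" and lam: "lam < - lambda_star (Suc d)"
  shows "(x, 1) \<in> ratio_pairs d lam"
proof -
  have "lambda_star (Suc d) \<ge> 0"
    by (simp add: lambda_star_def)
  then interpret ratio_cone "- lam" d "ratio_pairs d lam"
    using assms by (intro ratio_cone_ratio_pairs) auto
  \<comment> \<open>A hexagon vertex has degree 2, which \<open>d \<ge> 2\<close> admits for a
    child.\<close>
  have "1 / 2 \<in> ratios" if "- lam = 1"
  proof -
    have "realizable (Suc d) lam 2 1 1"
      using that assms(1) realizable_hexagon[of "Suc d"] by (simp add: minus_equation_iff)
    then have "(1, 1 + 1) \<in> vertex_pairs d lam"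
      unfolding vertex_pairs_def using assms(1) by blast
    then show ?thesis
      using ratioI[of 1 2] vertex_pairs_subset by auto
  qed
  then have "ratios = UNIV"
    using lam by (intro ratios_UNIV_above_threshold) auto
  then show ?thesis
    by (auto simp: ratios_def)
qed

theorem theorem1:
  fixes \<Delta> :: nat and lam :: real
  assumes "\<Delta> \<ge> 3" and "lam < - lambda_star \<Delta>"
  shows "\<forall>(lam'::real) (eps::real). eps > 0 \<longrightarrow>
    (\<exists>G :: nat pair_pre_digraph. pair_graph G \<and> bipartite G \<and> max_degree_at_most G \<Delta> \<and>
       implements_activity G lam lam' eps)"
proof (intro allI impI)
  fix lam' eps :: real
  assume eps: "eps > 0"
  obtain d where \<Delta>: "\<Delta> = Suc d" and d: "d \<ge> 2"
    using assms(1) by (cases \<Delta>) auto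
  have "lambda_star \<Delta> \<ge> 0"
    using assms(1) by (simp add: lambda_star_def)
  then have lam: "lam < 0"
    using assms(2) by simp
  text \<open>
    The pair \<open>(1, 1)\<close> stands for a missing child, which no graph realizes; aiming at a target other
    than \<open>lam\<close> keeps the approximants away from it.
  \<close>
  define t where "t = (if lam' = lam then lam' + eps / 2 else lam')"
  have t: "t \<noteq> lam" "\<bar>t - lam'\<bar> \<le> eps / 2"
    using eps by (auto simp: t_def)
  \<comment> \<open>The terminal will be a fresh leaf joined to a realized root; its activity is
    \<open>lam\<close> times the ratio of that root.\<close>
  have "(t / lam, 1) \<in> ratio_pairs d lam"
    using ratio_pairs_dense[OF d] assms(2) by (simp add: \<Delta>)
  then obtain f where f: "\<And>n. f n \<in> {c *\<^sub>R u | c u. u \<in> vertex_pairs d lam}"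
    and lim: "f \<longlonglongrightarrow> (t / lam, 1)"
    unfolding ratio_pairs_def closure_sequential by blast
  have lim2: "(\<lambda>n. snd (f n)) \<longlonglongrightarrow> 1"
    using tendsto_snd[OF lim] by simp
  have "(\<lambda>n. lam * (fst (f n) / snd (f n))) \<longlonglongrightarrow> lam * (t / lam / 1)"
    using tendsto_fst[OF lim] by (intro tendsto_intros lim2) auto
  then have ratio: "(\<lambda>n. lam * (fst (f n) / snd (f n))) \<longlonglongrightarrow> t"
    using lam by simp
  have "\<forall>\<^sub>F n in sequentially. snd (f n) \<noteq> 0 \<and> lam * (fst (f n) / snd (f n)) \<noteq> lam \<and>
      dist (lam * (fst (f n) / snd (f n))) t < eps / 2"
    using eps t(1)
    by (intro eventually_conj tendsto_imp_eventually_ne[OF lim2]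
        tendsto_imp_eventually_ne[OF ratio] tendstoD[OF ratio]) auto
  then obtain n where n: "snd (f n) \<noteq> 0" "lam * (fst (f n) / snd (f n)) \<noteq> lam"
    "dist (lam * (fst (f n) / snd (f n))) t < eps / 2"
    by (auto simp: eventually_sequentially)
  obtain c p q where c: "f n = c *\<^sub>R (p, q)" and pq: "(p, q) \<in> vertex_pairs d lam"
    using f[of n] by auto
  have q: "q \<noteq> 0" "(p, q) \<noteq> (1, 1)" and close: "\<bar>lam * p / q - t\<bar> < eps / 2"
    using n by (auto simp: c dist_real_def)
  then obtain k zi where k: "k \<le> d" "realizable \<Delta> lam k zi p" "q = zi + p"
    using pq by (auto simp: vertex_pairs_def \<Delta>)
  \<comment> \<open>The single vertex becomes the terminal of degree one; \<open>k \<le> d\<close>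
    leaves the old root room for the edge.\<close>
  have "realizable \<Delta> lam (Suc 0) (lam * p) (1 * q)"
    unfolding k(3) by (rule realizable_join[OF realizable_vertex k(2)]) (use k \<Delta> in auto)
  then obtain G :: "nat pair_pre_digraph" and v where
    "pair_graph G" "bipartite G" "max_degree_at_most G \<Delta>" "v \<in> pverts G"
    "out_degree (with_proj G) v = 1" "Z_in G v lam = lam * p" "Z_out G v lam = q"
    by (auto simp: realizable_def)
  moreover have "\<bar>lam * p / q - lam'\<bar> \<le> eps"
    using close t(2) by linarith
  ultimately show "\<exists>G :: nat pair_pre_digraph. pair_graph G \<and> bipartite G \<and>
      max_degree_at_most G \<Delta> \<and> implements_activity G lam lam' eps"
    unfolding implements_activity_def using q(1) by (intro exI[of _ G] conjI bexI[of _ v]) auto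
qed

end
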